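(* Let $V=\mathbb R^n$, $\varepsilon\in\mathbb R$, and let $r$, $s_\lambda$, $w_\lambda=r-is_\lambda$, the holomorphic Poisson bracket $\{\cdot,\cdot\}$ on $(T^*V)^{\mathbb C}\cong\mathbb C^{2n}$, the function $\Lambda$, the open set $P^{\mathbb C}=\{\Lambda\neq0\}$ and the antilinear multiplicative involution $*$ on holomorphic functions on $P^{\mathbb C}$ be as defined in the context. Then the Poisson structure is real with respect to the star operation: for all holomorphic functions $f,g$ on $P^{\mathbb C}$, $$\{f,g\}^*=\{f^*,g^*\}.$$
   Context: Let $e_j{}^k$ be the matrix units ($e_j{}^kx=x^ke_j$), $M_j{}^k=e_j{}^k-e_k{}^j$, $j'=n+1-j$, and $a\wedge b=a\otimes b-b\otimes a$. The standard $r$-matrix on $so(n,\mathbb R)$ is $r=\varepsilon\sum_{j<k<j'}M_j{}^k\wedge M_k{}^{j'}$. Put $$s_\lambda=\varepsilon\sum_{j,k}\big(e_j{}^k\otimes e_k{}^j-e_j{}^k\otimes e_j{}^k+e_j{}^j\otimes e_k{}^k\big),\qquad w_\lambda=r-is_\lambda.$$ Components: $\rho=\sum\rho^{jk}_{lm}e_j{}^l\otimes e_k{}^m$. On $(T^*V)^{\mathbb C}\cong\mathbb C^{2n}$ with holomorphic coordinates $x^j,p_j$, the holomorphic Poisson structure is given by (summation convention) $$\{x^j,x^k\}=r^{jk}_{lm}x^lx^m,\qquad \{p_l,p_m\}=p_jp_kr^{jk}_{lm},\qquad \{p_l,x^k\}=\delta_l^k-p_j(w_\lambda)^{jk}_{lm}x^m.$$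 Indices are raised and lowered with the Euclidean metric $\delta_{jk}$; $x^2=\sum_j x^jx^j$, $p^2=\sum_jp_jp_j$, $E=\sum_jp_jx^j$, and $\Lambda=1+2i\varepsilon E-\varepsilon^2x^2p^2$. Let $P^{\mathbb C}=\{(x,p)\in(T^*V)^{\mathbb C}:\Lambda\ne0\}$. Let $\psi\colon P^{\mathbb C}\to P^{\mathbb C}$ be the anti-holomorphic involution for which the map $f\mapsto f^*:=\overline{f\circ\psi}$ on holomorphic functions satisfies $$(x^j)^*=x^j,\qquad (p_j)^*=\frac{p_j+i\varepsilon p^2x_j}{\Lambda}.$$ (Equivalently, $\psi(x,p)=(\overline{x},\overline{T/\Lambda})$ with $T_j=p_j+i\varepsilon p^2x_j$.) *)

theory Defs
  imports "HOL-Analysis.Analysis"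
begin

text \<open>
  The index set \<open>{1, \<dots>, n}\<close> is an arbitrary finite linearly ordered type \<open>'n\<close>, with
  \<open>n = CARD('n)\<close>; \<open>position j \<in> {1, \<dots>, n}\<close> is the number of the index \<open>j\<close>, so that
  \<open>mirror j\<close> is \<open>j' = n + 1 - j\<close>.
\<close>

definition position :: "'n::{finite,linorder} \<Rightarrow> nat"
  where "position j = card {i. i \<le> j}"

definition mirror :: "'n::{finite,linorder} \<Rightarrow> 'n"
  where "mirror j = (THE k. position k = CARD('n) + 1 - position j)"

lemma position_less_iff: "position j < position k \<longleftrightarrow> j < k"
  for j k :: "'n::{finite,linorder}"
proof -
  have mono: "position a < position b" if "a < b" for a b :: 'n
    unfolding position_def using that
    by (intro psubset_card_mono) (auto simp: psubset_eq set_eq_iff dest: leD)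
  then show ?thesis
    by (metis less_asym neq_iff)
qed

lemma bij_position: "bij_betw (position :: 'n::{finite,linorder} \<Rightarrow> nat) UNIV {1..CARD('n)}"
proof -
  have inj: "inj (position :: 'n \<Rightarrow> nat)"
    by (rule injI) (metis position_less_iff neq_iff)
  have sub: "range (position :: 'n \<Rightarrow> nat) \<subseteq> {1..CARD('n)}"
  proof clarify
    fix j :: 'n
    have "card {i. i \<le> j} \<ge> card {j}" by (rule card_mono) auto
    moreover have "card {i. i \<le> j} \<le> CARD('n)" by (rule card_mono) auto
    ultimately show "position j \<in> {1..CARD('n)}" by (simp add: position_def)
  qed
  have "card (range (position :: 'n \<Rightarrow> nat)) = CARD('n)"
    by (rule card_image[OF inj])
  then have "range (position :: 'n \<Rightarrow> nat) = {1..CARD('n)}"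
    using sub by (intro card_subset_eq) auto
  with inj show ?thesis by (simp add: bij_betw_def)
qed

lemma position_mirror: "position (mirror j) = CARD('n) + 1 - position j"
  for j :: "'n::{finite,linorder}"
proof -
  have "position j \<in> {1..CARD('n)}" using bij_position bij_betwE by blast
  then have "CARD('n) + 1 - position j \<in> {1..CARD('n)}" by auto
  then have "\<exists>!k::'n. position k = CARD('n) + 1 - position j"
    using bij_position[where 'n = 'n] unfolding bij_betw_def
    by (metis (no_types, lifting) imageE injD)
  then show ?thesis unfolding mirror_def by (rule theI')
qed

text \<open>
  The prefix form of the vector type leaves the sort of the index type open, whereas the infix
  form forces the sort \<open>finite\<close> on every occurrence of it.
\<close>

type_synonym 'n rmat = "((real, 'n) vec, 'n) vec"
type_synonym ('a, 'n) tensor4 = "(((('a, 'n) vec, 'n) vec, 'n) vec, 'n) vec"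
type_synonym 'n phase_pt = "(complex, 'n) vec \<times> (complex, 'n) vec"

definition mat_unit :: "'n::finite \<Rightarrow> 'n \<Rightarrow> 'n rmat"
  where "mat_unit j k = (\<chi> a b. if a = j \<and> b = k then 1 else 0)"

lemma mat_unit_mult: "mat_unit j k *v x = (x $ k) *s axis j 1"
  for j k :: "'n::finite"
  by (auto simp: vec_eq_iff mat_unit_def matrix_vector_mult_def axis_def if_distrib if_distribR
      cong: if_cong)

definition so_gen :: "'n::finite \<Rightarrow> 'n \<Rightarrow> 'n rmat"
  where "so_gen j k = mat_unit j k - mat_unit k j"

text \<open>
  An element \<open>T\<close> of \<open>gl(n) \<otimes> gl(n)\<close> is represented by its array of components:
  \<open>T $ j $ k $ l $ m\<close> is the coefficient of \<open>mat_unit j l \<otimes> mat_unit k m\<close>.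
\<close>

definition tensor :: "('n::finite) rmat \<Rightarrow> 'n rmat \<Rightarrow> (real, 'n) tensor4"
  where "tensor A B = (\<chi> j k l m. A $ j $ l * B $ k $ m)"

definition wedge :: "('n::finite) rmat \<Rightarrow> 'n rmat \<Rightarrow> (real, 'n) tensor4"
  where "wedge A B = tensor A B - tensor B A"

definition r_std :: "real \<Rightarrow> (real, 'n::{finite,linorder}) tensor4"
  where "r_std \<epsilon> = \<epsilon> *\<^sub>R (\<Sum>(j, k) | j < k \<and> k < mirror j. wedge (so_gen j k) (so_gen k (mirror j)))"

definition s_lam :: "real \<Rightarrow> (real, 'n::finite) tensor4"
  where "s_lam \<epsilon> = \<epsilon> *\<^sub>R (\<Sum>j\<in>UNIV. \<Sum>k\<in>UNIV.
      tensor (mat_unit j k) (mat_unit k j) - tensor (mat_unit j k) (mat_unit j k)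
      + tensor (mat_unit j j) (mat_unit k k))"

definition w_lam :: "real \<Rightarrow> (complex, 'n::{finite,linorder}) tensor4"
  where "w_lam \<epsilon> = (\<chi> j k l m. complex_of_real (r_std \<epsilon> $ j $ k $ l $ m)
      - \<i> * complex_of_real (s_lam \<epsilon> $ j $ k $ l $ m))"

text \<open>
  Points of the complexified cotangent bundle are pairs \<open>(x, p)\<close>. The form below is complex
  bilinear (not Hermitian): \<open>cdot x x\<close>, \<open>cdot p p\<close>, \<open>cdot p x\<close> are \<open>x\<^sup>2\<close>, \<open>p\<^sup>2\<close>, \<open>E\<close>.
\<close>

definition cdot :: "complex^'n::finite \<Rightarrow> complex^'n \<Rightarrow> complex"
  where "cdot u v = (\<Sum>j\<in>UNIV. u $ j * v $ j)"

definition Lam :: "real \<Rightarrow> ('n::finite) phase_pt \<Rightarrow> complex"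
  where "Lam \<epsilon> = (\<lambda>(x, p). 1 + 2 * \<i> * complex_of_real \<epsilon> * cdot p x
      - (complex_of_real \<epsilon>)\<^sup>2 * cdot x x * cdot p p)"

definition PC :: "real \<Rightarrow> ('n::finite) phase_pt set"
  where "PC \<epsilon> = {z. Lam \<epsilon> z \<noteq> 0}"

text \<open>
  Holomorphy in several variables: complex Frechet differentiability, i.e. real Frechet
  differentiability with complex linear derivative. Only used for the open set \<open>PC \<epsilon>\<close>.
\<close>

definition mv_holomorphic_on ::
    "(('n::finite) phase_pt \<Rightarrow> complex) \<Rightarrow> 'n phase_pt set \<Rightarrow> bool"
  where "mv_holomorphic_on f S \<longleftrightarrow> (\<forall>z\<in>S. \<exists>D. (f has_derivative D) (at z within S)
      \<and> (\<forall>c u v. D (c *s u, c *s v) = c * D (u, v)))"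

definition dx :: "'n::finite \<Rightarrow> ('n phase_pt \<Rightarrow> complex)
    \<Rightarrow> 'n phase_pt \<Rightarrow> complex"
  where "dx j f = (\<lambda>(x, p). deriv (\<lambda>t. f (x + axis j t, p)) 0)"

definition dp :: "'n::finite \<Rightarrow> ('n phase_pt \<Rightarrow> complex)
    \<Rightarrow> 'n phase_pt \<Rightarrow> complex"
  where "dp j f = (\<lambda>(x, p). deriv (\<lambda>t. f (x, p + axis j t)) 0)"

text \<open>The brackets \<open>{x\<^sup>j, x\<^sup>k}\<close>, \<open>{p\<^sub>l, p\<^sub>m}\<close>, \<open>{p\<^sub>l, x\<^sup>k}\<close> of the coordinate functions.\<close>

definition br_xx :: "real \<Rightarrow> 'n::{finite,linorder} \<Rightarrow> 'n \<Rightarrow> 'n phase_pt \<Rightarrow> complex"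
  where "br_xx \<epsilon> j k = (\<lambda>(x, p). \<Sum>l\<in>UNIV. \<Sum>m\<in>UNIV.
      complex_of_real (r_std \<epsilon> $ j $ k $ l $ m) * x $ l * x $ m)"

definition br_pp :: "real \<Rightarrow> 'n::{finite,linorder} \<Rightarrow> 'n \<Rightarrow> 'n phase_pt \<Rightarrow> complex"
  where "br_pp \<epsilon> l m = (\<lambda>(x, p). \<Sum>j\<in>UNIV. \<Sum>k\<in>UNIV.
      p $ j * p $ k * complex_of_real (r_std \<epsilon> $ j $ k $ l $ m))"

definition br_px :: "real \<Rightarrow> 'n::{finite,linorder} \<Rightarrow> 'n \<Rightarrow> 'n phase_pt \<Rightarrow> complex"
  where "br_px \<epsilon> l k = (\<lambda>(x, p). (if l = k then 1 else 0)
      - (\<Sum>j\<in>UNIV. \<Sum>m\<in>UNIV. p $ j * w_lam \<epsilon> $ j $ k $ l $ m * x $ m))"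

definition pbracket :: "real \<Rightarrow> (('n::{finite,linorder}) phase_pt \<Rightarrow> complex)
    \<Rightarrow> ('n phase_pt \<Rightarrow> complex) \<Rightarrow> 'n phase_pt \<Rightarrow> complex"
  where "pbracket \<epsilon> f g z = (\<Sum>j\<in>UNIV. \<Sum>k\<in>UNIV.
        dx j f z * dx k g z * br_xx \<epsilon> j k z
      + dp j f z * dp k g z * br_pp \<epsilon> j k z
      + dp j f z * dx k g z * br_px \<epsilon> j k z
      - dx k f z * dp j g z * br_px \<epsilon> j k z)"

definition vcnj :: "complex^'n \<Rightarrow> complex^'n"
  where "vcnj u = (\<chi> j. cnj (u $ j))"

definition psi :: "real \<Rightarrow> ('n::finite) phase_pt \<Rightarrow> 'n phase_pt"
  where "psi \<epsilon> = (\<lambda>(x, p). (vcnj x,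
      vcnj (\<chi> j. (p $ j + \<i> * complex_of_real \<epsilon> * cdot p p * x $ j) / Lam \<epsilon> (x, p))))"

definition star_op :: "real \<Rightarrow> (('n::finite) phase_pt \<Rightarrow> complex)
    \<Rightarrow> 'n phase_pt \<Rightarrow> complex"
  where "star_op \<epsilon> f = cnj \<circ> f \<circ> psi \<epsilon>"

text \<open>Consistency of the definitions with their intended properties.\<close>

lemma open_PC: "open (PC \<epsilon> :: ('n::finite) phase_pt set)"
proof -
  have "continuous_on UNIV (Lam \<epsilon> :: 'n phase_pt \<Rightarrow> complex)"
    unfolding Lam_def cdot_def case_prod_unfold by (intro continuous_intros)
  then show ?thesis
    unfolding PC_def by (intro open_Collect_neq) (auto intro: continuous_intros)
qed

lemma star_op_x: "star_op \<epsilon> (\<lambda>(x, p). x $ j) (x, p) = x $ j"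
  by (simp add: star_op_def psi_def vcnj_def)

lemma star_op_p: "star_op \<epsilon> (\<lambda>(x, p). p $ j) (x, p)
    = (p $ j + \<i> * complex_of_real \<epsilon> * cdot p p * x $ j) / Lam \<epsilon> (x, p)"
  by (simp add: star_op_def psi_def vcnj_def)

lemma cdot_vcnj: "cdot (vcnj u) (vcnj v) = cnj (cdot u v)"
  by (simp add: cdot_def vcnj_def)

lemma cdot_commute: "cdot u v = cdot v u"
  by (simp add: cdot_def mult.commute)

lemma cdot_add_left: "cdot (u + v) w = cdot u w + cdot v w"
  by (simp add: cdot_def sum.distrib algebra_simps)

lemma cdot_add_right: "cdot w (u + v) = cdot w u + cdot w v"
  by (simp add: cdot_def sum.distrib algebra_simps)

lemma cdot_smult_left: "cdot (c *s u) v = c * cdot u v"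
  by (simp add: cdot_def sum_distrib_left algebra_simps)

lemma cdot_smult_right: "cdot u (c *s v) = c * cdot u v"
  by (simp add: cdot_def sum_distrib_left algebra_simps)

lemmas cdot_bilinear = cdot_add_left cdot_add_right cdot_smult_left cdot_smult_right

lemma vcnj_vcnj: "vcnj (vcnj u) = u"
  by (simp add: vcnj_def vec_eq_iff)

lemma psi_alt: "psi \<epsilon> (x, p) = (vcnj x, vcnj ((1 / Lam \<epsilon> (x, p)) *s
    (p + (\<i> * complex_of_real \<epsilon> * cdot p p) *s x)))"
  by (simp add: psi_def vec_eq_iff vcnj_def add_divide_distrib diff_divide_distrib)

context
  fixes \<epsilon> :: real and x p q :: "complex^'n" and e L :: complex
  assumes L0: "Lam \<epsilon> (x, p) \<noteq> 0"
  defines "e \<equiv> complex_of_real \<epsilon>" and "L \<equiv> Lam \<epsilon> (x, p)"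
    and "q \<equiv> (1 / L) *s (p + (\<i> * e * cdot p p) *s x)"
begin

lemma psi_q: "psi \<epsilon> (x, p) = (vcnj x, vcnj q)"
  by (simp add: psi_alt q_def L_def e_def)

lemma L_eq: "L = 1 + 2 * \<i> * e * cdot p x - e\<^sup>2 * cdot x x * cdot p p"
  by (simp add: L_def Lam_def e_def)

lemma L_nz: "L \<noteq> 0"
  using L0 by (simp add: L_def)

lemma cdot_qx: "cdot q x = (cdot p x + \<i> * e * cdot p p * cdot x x) / L"
  by (simp add: q_def cdot_bilinear add_divide_distrib)

lemma cdot_qq: "cdot q q = cdot p p / L"
proof -
  have "cdot q q = (cdot p p + 2 * (\<i> * e * cdot p p) * cdot p x
      + (\<i> * e * cdot p p)\<^sup>2 * cdot x x) / L\<^sup>2"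
    by (simp add: q_def cdot_bilinear cdot_commute[of x p] power2_eq_square algebra_simps
        add_divide_distrib diff_divide_distrib)
  also have "\<dots> = cdot p p * L / L\<^sup>2"
    by (simp add: L_eq algebra_simps power2_eq_square)
  finally show ?thesis
    using L_nz by (simp add: power2_eq_square)
qed

lemma Lam_psi_aux: "Lam \<epsilon> (psi \<epsilon> (x, p)) = cnj (1 / L)"
proof -
  have "Lam \<epsilon> (psi \<epsilon> (x, p)) = cnj (1 - 2 * \<i> * e * cdot q x - e\<^sup>2 * cdot x x * cdot q q)"
    by (simp add: psi_q Lam_def cdot_vcnj e_def)
  also have "1 - 2 * \<i> * e * cdot q x - e\<^sup>2 * cdot x x * cdot q q
      = (L - 2 * \<i> * e * (cdot p x + \<i> * e * cdot p p * cdot x x) - e\<^sup>2 * cdot x x * cdot p p) / L"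
    using L_nz by (simp add: cdot_qx cdot_qq diff_divide_distrib)
  also have "L - 2 * \<i> * e * (cdot p x + \<i> * e * cdot p p * cdot x x) - e\<^sup>2 * cdot x x * cdot p p = 1"
    by (simp add: L_eq algebra_simps power2_eq_square)
  finally show ?thesis .
qed

lemma psi_psi_aux: "psi \<epsilon> (psi \<epsilon> (x, p)) = (x, p)"
proof -
  have "Lam \<epsilon> (vcnj x, vcnj q) = cnj (1 / L)"
    using Lam_psi_aux by (simp add: psi_q)
  then have "psi \<epsilon> (vcnj x, vcnj q)
      = (x, vcnj (cnj L *s (vcnj q + (\<i> * e * cnj (cdot q q)) *s vcnj x)))"
    by (simp add: psi_alt vcnj_vcnj cdot_vcnj e_def)
  then have "psi \<epsilon> (psi \<epsilon> (x, p))
      = (x, vcnj (cnj L *s (vcnj q + (\<i> * e * cnj (cdot q q)) *s vcnj x)))"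
    by (simp only: psi_q)
  also have "vcnj (cnj L *s (vcnj q + (\<i> * e * cnj (cdot q q)) *s vcnj x))
      = L *s (q - (\<i> * e * cdot q q) *s x)"
    by (simp add: vec_eq_iff vcnj_def e_def)
  also have "\<dots> = p"
    unfolding cdot_qq using L_nz by (simp add: vec_eq_iff q_def field_simps)
  finally show ?thesis .
qed

end

lemma Lam_psi: "z \<in> PC \<epsilon> \<Longrightarrow> Lam \<epsilon> (psi \<epsilon> z) = 1 / cnj (Lam \<epsilon> z)"
  using Lam_psi_aux by (cases z) (auto simp: PC_def)

lemma psi_in_PC: "z \<in> PC \<epsilon> \<Longrightarrow> psi \<epsilon> z \<in> PC \<epsilon>"
  using Lam_psi[of z \<epsilon>] by (simp add: PC_def)

lemma psi_psi: "z \<in> PC \<epsilon> \<Longrightarrow> psi \<epsilon> (psi \<epsilon> z) = z"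
  using psi_psi_aux by (cases z) (auto simp: PC_def)

lemma deriv_shift: "deriv (\<lambda>t::complex. a + t) z = 1" "deriv (\<lambda>t::complex. a) z = 0"
  by (auto intro!: DERIV_imp_deriv derivative_eq_intros)

lemma d_coordinates:
  "dx j (\<lambda>(x, p). x $ k) = (\<lambda>z. if j = k then 1 else 0)"
  "dx j (\<lambda>(x, p). p $ k) = (\<lambda>z. 0)"
  "dp j (\<lambda>(x, p). x $ k) = (\<lambda>z. 0)"
  "dp j (\<lambda>(x, p). p $ k) = (\<lambda>z. if j = k then 1 else 0)"
  by (auto simp: dx_def dp_def axis_def fun_eq_iff deriv_shift)

lemma sum_delta2:
  "(\<Sum>j\<in>UNIV. \<Sum>k\<in>UNIV. (if j = a then 1 else 0) * (if k = b then 1 else 0) * h j k) = h a b"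
  for h :: "'n::finite \<Rightarrow> 'n \<Rightarrow> complex"
  by (simp add: if_distrib[of "\<lambda>c. c * _"] sum.If_cases cong: if_cong)

lemma pbracket_coordinates:
  "pbracket \<epsilon> (\<lambda>(x, p). x $ j) (\<lambda>(x, p). x $ k) z = br_xx \<epsilon> j k z"
  "pbracket \<epsilon> (\<lambda>(x, p). p $ j) (\<lambda>(x, p). p $ k) z = br_pp \<epsilon> j k z"
  "pbracket \<epsilon> (\<lambda>(x, p). p $ j) (\<lambda>(x, p). x $ k) z = br_px \<epsilon> j k z"
  "pbracket \<epsilon> (\<lambda>(x, p). x $ k) (\<lambda>(x, p). p $ j) z = - br_px \<epsilon> j k z"
  by (simp_all add: pbracket_def d_coordinates sum_delta2 sum_negf
      mult.commute[of "if _ = k then 1 else 0" "if _ = j then 1 else 0"])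

end

theory Submission
  imports Defs
begin

text \<open>
  Write \<open>e = i \<epsilon>\<close>, \<open>L = \<Lambda>\<close> and \<open>q = (p + e p\<^sup>2 x) / L\<close>, so that \<open>\<psi>(x, p)\<close> is the complex conjugate
  of \<open>(x, q)\<close>. Since \<open>r\<close> lies in \<open>so(n) \<otimes> so(n)\<close>, its contribution to the bivector, on covectors with
  components \<open>a\<close> along \<open>dx\<close> and \<open>b\<close> along \<open>dp\<close>, is \<open>r\<close> evaluated on two copies of
  \<open>a \<and> x + b \<and> p\<close>, the differential of the moment map for the rotation action. This quantity is
  unchanged under pulling covectors back along \<open>(x, p) \<mapsto> (x, q)\<close>, so no finer property of \<open>r\<close>
  is needed. The remaining terms depend only on the Euclidean pairing, and the same pullback turns
  \<open>e\<close> into \<open>- e\<close> in them, which is complex conjugation of the coefficients.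
\<close>

section \<open>The bracket as a bivector\<close>

text \<open>Reads \<open>r\<close> as a bilinear form on arrays, with \<open>A\<close> filling the
  first tensor leg and \<open>B\<close> the second, so that the antisymmetries of \<open>r\<close>
  become identities about \<open>A\<close> and \<open>B\<close>.\<close>

definition r_form :: "real \<Rightarrow> ('n::{finite,linorder} \<Rightarrow> 'n \<Rightarrow> complex)
    \<Rightarrow> ('n \<Rightarrow> 'n \<Rightarrow> complex) \<Rightarrow> complex"
  where "r_form \<epsilon> A B = (\<Sum>j\<in>UNIV. \<Sum>k\<in>UNIV. \<Sum>l\<in>UNIV. \<Sum>m\<in>UNIV.
      complex_of_real (r_std \<epsilon> $ j $ k $ l $ m) * A j l * B k m)"

section \<open>Antisymmetries of the r-matrix\<close>

lemma mat_unit_transpose: "mat_unit j k $ b $ a = mat_unit k j $ a $ b"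
  unfolding mat_unit_def vec_lambda_beta by (rule if_cong) auto

lemma so_gen_antisym: "so_gen j k $ b $ a = - so_gen j k $ a $ b"
  by (simp add: so_gen_def mat_unit_transpose[of j k b] mat_unit_transpose[of k j b])

lemma r_std_nth: "r_std \<epsilon> $ j $ k $ l $ m = (\<Sum>(a, b) | a < b \<and> b < mirror a.
    \<epsilon> * (so_gen a b $ j $ l * so_gen b (mirror a) $ k $ m
      - so_gen b (mirror a) $ j $ l * so_gen a b $ k $ m))"
  by (simp add: r_std_def wedge_def tensor_def case_prod_unfold sum_distrib_left)

text \<open>A wedge changes sign when its two tensor factors are exchanged.\<close>

lemma r_std_swap_factors: "r_std \<epsilon> $ k $ j $ m $ l = - r_std \<epsilon> $ j $ k $ l $ m"
  unfolding r_std_nth sum_negf[symmetric] by (rule sum.cong) (auto simp: algebra_simps)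

text \<open>Exchanging \<open>j\<close> and \<open>l\<close> transposes the first tensor factor, an
  element of so(n).\<close>

lemma r_std_swap_left: "r_std \<epsilon> $ l $ k $ j $ m = - r_std \<epsilon> $ j $ k $ l $ m"
  unfolding r_std_nth sum_negf[symmetric]
  by (rule sum.cong) (auto simp: so_gen_antisym[of _ _ l j] algebra_simps)

text \<open>Transposing the second leg amounts to transposing the first one between two exchanges of
  the legs.\<close>

lemma r_std_swap_right: "r_std \<epsilon> $ j $ m $ l $ k = - r_std \<epsilon> $ j $ k $ l $ m"
  using r_std_swap_factors[of \<epsilon> j m l k] r_std_swap_left[of \<epsilon> m j k l] r_std_swap_factors[of \<epsilon> j k l m]
  by simp

lemma r_form_swap: "r_form \<epsilon> B A = - r_form \<epsilon> A B"
proof -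
  have "r_form \<epsilon> B A = (\<Sum>k\<in>UNIV. \<Sum>j\<in>UNIV. \<Sum>m\<in>UNIV. \<Sum>l\<in>UNIV.
      complex_of_real (r_std \<epsilon> $ k $ j $ m $ l) * B k m * A j l)"
    by (simp add: r_form_def)
  also have "\<dots> = (\<Sum>k\<in>UNIV. \<Sum>j\<in>UNIV. \<Sum>l\<in>UNIV. \<Sum>m\<in>UNIV.
      complex_of_real (r_std \<epsilon> $ k $ j $ m $ l) * B k m * A j l)"
    by (rule sum.cong[OF refl], rule sum.cong[OF refl], rule sum.swap)
  also have "\<dots> = (\<Sum>j\<in>UNIV. \<Sum>k\<in>UNIV. \<Sum>l\<in>UNIV. \<Sum>m\<in>UNIV.
      complex_of_real (r_std \<epsilon> $ k $ j $ m $ l) * B k m * A j l)"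
    by (rule sum.swap)
  also have "\<dots> = - r_form \<epsilon> A B"
    unfolding r_form_def sum_negf[symmetric]
    by (intro sum.cong refl) (subst r_std_swap_factors, simp)
  finally show ?thesis .
qed

lemma r_form_diff_left: "r_form \<epsilon> (\<lambda>j l. A j l - B j l) C = r_form \<epsilon> A C - r_form \<epsilon> B C"
  by (simp add: r_form_def sum_subtractf[symmetric] algebra_simps)

lemma r_form_add_left: "r_form \<epsilon> (\<lambda>j l. A j l + B j l) C = r_form \<epsilon> A C + r_form \<epsilon> B C"
  by (simp add: r_form_def sum.distrib[symmetric] algebra_simps)

lemma r_form_add_right: "r_form \<epsilon> C (\<lambda>j l. A j l + B j l) = r_form \<epsilon> C A + r_form \<epsilon> C B"
  by (simp add: r_form_def sum.distrib[symmetric] algebra_simps)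

lemma r_form_transpose: "r_form \<epsilon> (\<lambda>j l. A l j) B = - r_form \<epsilon> A B"
proof -
  \<comment> \<open>\<open>j\<close> and \<open>l\<close> belong to the same leg, so their sums are
    made adjacent before being interchanged and renamed.\<close>
  have "r_form \<epsilon> (\<lambda>j l. A l j) B = (\<Sum>j\<in>UNIV. \<Sum>l\<in>UNIV. \<Sum>k\<in>UNIV. \<Sum>m\<in>UNIV.
      complex_of_real (r_std \<epsilon> $ j $ k $ l $ m) * A l j * B k m)"
    unfolding r_form_def by (rule sum.cong[OF refl], rule sum.swap)
  also have "\<dots> = (\<Sum>l\<in>UNIV. \<Sum>j\<in>UNIV. \<Sum>k\<in>UNIV. \<Sum>m\<in>UNIV.
      complex_of_real (r_std \<epsilon> $ j $ k $ l $ m) * A l j * B k m)"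
    by (rule sum.swap)
  also have "\<dots> = (\<Sum>j\<in>UNIV. \<Sum>k\<in>UNIV. \<Sum>l\<in>UNIV. \<Sum>m\<in>UNIV.
      complex_of_real (r_std \<epsilon> $ l $ k $ j $ m) * A j l * B k m)"
    by (rule sum.cong[OF refl], rule sum.swap)
  also have "\<dots> = - r_form \<epsilon> A B"
    unfolding r_form_def sum_negf[symmetric]
    by (intro sum.cong refl) (subst r_std_swap_left, simp)
  finally show ?thesis .
qed

text \<open>Links the coordinate brackets, which involve plain tensor products of a covector and a
  point, with \<open>moment\<close>, which is antisymmetrized.\<close>

lemma r_form_antisymmetrize:
  "r_form \<epsilon> (\<lambda>j l. A j l - A l j) (\<lambda>k m. B k m - B m k) = 4 * r_form \<epsilon> A B"
proof -
  have left: "r_form \<epsilon> (\<lambda>j l. C j l - C l j) D = 2 * r_form \<epsilon> C D" for C D :: "'a \<Rightarrow> 'a \<Rightarrow> complex"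
    by (simp add: r_form_diff_left r_form_transpose[of \<epsilon> C])
  \<comment> \<open>The right slot is reduced to the left one by exchanging the slots, doubling, and
    exchanging back.\<close>
  have "r_form \<epsilon> A (\<lambda>k m. B k m - B m k) = 2 * r_form \<epsilon> A B"
    using left[of B A] r_form_swap[of \<epsilon> "\<lambda>k m. B k m - B m k" A] r_form_swap[of \<epsilon> B A]
    by simp
  with left[of A "\<lambda>k m. B k m - B m k"] show ?thesis
    by simp
qed

definition moment :: "('n::finite) phase_pt \<Rightarrow> complex^'n \<Rightarrow> complex^'n \<Rightarrow> 'n \<Rightarrow> 'n \<Rightarrow> complex"
  where "moment = (\<lambda>(x, p) a b j l. (a $ j * x $ l + b $ j * p $ l) - (a $ l * x $ j + b $ l * p $ j))"

definition grad_x :: "(('n::finite) phase_pt \<Rightarrow> complex) \<Rightarrow> 'n phase_pt \<Rightarrow> complex^'n"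
  where "grad_x f z = (\<chi> j. dx j f z)"

definition grad_p :: "(('n::finite) phase_pt \<Rightarrow> complex) \<Rightarrow> 'n phase_pt \<Rightarrow> complex^'n"
  where "grad_p f z = (\<chi> j. dp j f z)"

text \<open>The three terms come, in order, from the flip, its partial transpose and the identity,
  which are the three sums in \<open>s_lam\<close>.\<close>

definition s_form :: "('n::finite) phase_pt \<Rightarrow> complex^'n \<Rightarrow> complex^'n \<Rightarrow> complex"
  where "s_form = (\<lambda>(x, p) a b. cdot p x * cdot a b - cdot p a * cdot b x + cdot p b * cdot a x)"

text \<open>The contribution of the brackets of \<open>p\<close> with \<open>x\<close>, without
  their \<open>r\<close> term, for \<open>dx\<close> component \<open>a\<close> and
  \<open>dp\<close> component \<open>b\<close>. The parameter \<open>e\<close>, equal to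
  \<open>\<i> * complex_of_real \<epsilon>\<close> for the actual bracket, is kept free because its
  sign has to change.\<close>

definition px_form :: "complex \<Rightarrow> ('n::finite) phase_pt \<Rightarrow> complex^'n \<Rightarrow> complex^'n \<Rightarrow> complex"
  where "px_form e z a b = cdot b a + e * s_form z a b"

text \<open>
  Each of the two moments is an antisymmetrization, which doubles \<open>r_form\<close> in that slot; hence the
  division by 4.
\<close>

definition bivector :: "complex \<Rightarrow> real \<Rightarrow> ('n::{finite,linorder}) phase_pt
    \<Rightarrow> (complex, 'n) vec \<Rightarrow> (complex, 'n) vec \<Rightarrow> (complex, 'n) vec \<Rightarrow> (complex, 'n) vec \<Rightarrow> complex"
  where "bivector e \<epsilon> z a b a' b' = r_form \<epsilon> (moment z a b) (moment z a' b') / 4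
      + px_form e z a' b - px_form e z a b'"

section \<open>Contracting the coordinate brackets with covectors\<close>

lemma sum_sum_indicator:
  "(\<Sum>a\<in>UNIV. \<Sum>b\<in>UNIV. (if u = a \<and> v = b then 1 else 0) * h a b) = h u v"
  for h :: "'n::finite \<Rightarrow> 'n \<Rightarrow> real"
proof -
  have "(if u = a \<and> v = b then 1 else 0) * h a b = (if v = b then if u = a then h a b else 0 else 0)" for a b
    by simp
  then show ?thesis
    by simp
qed

lemma s_lam_nth: "s_lam \<epsilon> $ l $ k $ j $ m = \<epsilon> * ((if k = j \<and> m = l then 1 else 0)
    - (if k = l \<and> m = j then 1 else 0) + (if j = l \<and> m = k then 1 else 0))"
proof -
  \<comment> \<open>In the identity term each indicator involves only one summation index.
    Regrouping gives an indicator that fixes both \<open>a\<close> and \<open>b\<close>, as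
    \<open>sum_sum_indicator\<close> expects.\<close>
  have "(\<Sum>a\<in>UNIV. \<Sum>b\<in>UNIV. (if l = a \<and> j = a then 1 else 0) * (if k = b \<and> m = b then 1 else 0))
      = (\<Sum>a\<in>UNIV. \<Sum>b\<in>UNIV. (if l = a \<and> k = b then 1 else 0) * (if j = a \<and> m = b then 1 else (0::real)))"
    by (intro sum.cong) auto
  then show ?thesis
    unfolding s_lam_def tensor_def mat_unit_def
    by (simp only: sum_component vector_scaleR_component vector_add_component vector_minus_component
        vec_lambda_beta sum.distrib sum_subtractf sum_sum_indicator real_scaleR_def)
qed

lemma s_lam_contraction:
  "(\<Sum>l\<in>UNIV. \<Sum>m\<in>UNIV. p $ l * complex_of_real (s_lam \<epsilon> $ l $ k $ j $ m) * x $ m)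
    = complex_of_real \<epsilon> * ((if k = j then cdot p x else 0) - p $ k * x $ j + p $ j * x $ k)"
proof -
  \<comment> \<open>The conditionals are nested with \<open>m\<close> outermost because the inner
    sum runs over \<open>m\<close>; each sum then collapses to one term.\<close>
  have "p $ l * complex_of_real (s_lam \<epsilon> $ l $ k $ j $ m) * x $ m = complex_of_real \<epsilon> *
      ((if m = l then if k = j then p $ l * x $ m else 0 else 0)
       - (if m = j then if k = l then p $ l * x $ m else 0 else 0)
       + (if m = k then if j = l then p $ l * x $ m else 0 else 0))" for l m
    by (auto simp: s_lam_nth)
  then show ?thesis
    by (simp add: sum_distrib_left[symmetric] sum.distrib sum_subtractf cdot_def)
qed

text \<open>The minus sign before \<open>w_lam\<close> is absorbed in both parts:
  \<open>s_lam\<close> enters \<open>w_lam\<close> with factor \<open>- \<i>\<close>, and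
  transposing the first leg of \<open>r\<close> changes the sign while putting \<open>b\<close>
  before \<open>p\<close>.\<close>

lemma br_px_contraction:
  "(\<Sum>j\<in>UNIV. \<Sum>k\<in>UNIV. b $ j * a $ k * br_px \<epsilon> j k (x, p))
    = cdot b a + r_form \<epsilon> (\<lambda>j l. b $ j * p $ l) (\<lambda>k m. a $ k * x $ m)
      + \<i> * complex_of_real \<epsilon> * s_form (x, p) a b"
proof -
  let ?r = "\<lambda>j k l m. complex_of_real (r_std \<epsilon> $ j $ k $ l $ m)"
  have br: "br_px \<epsilon> j k (x, p) = (if j = k then 1 else 0) + (\<Sum>l\<in>UNIV. \<Sum>m\<in>UNIV. ?r j k l m * p $ l * x $ m)
      + \<i> * complex_of_real \<epsilon> * ((if k = j then cdot p x else 0) - p $ k * x $ j + p $ j * x $ k)" for j k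
  proof -
    have "(\<Sum>l\<in>UNIV. \<Sum>m\<in>UNIV. p $ l * w_lam \<epsilon> $ l $ k $ j $ m * x $ m)
       = (\<Sum>l\<in>UNIV. \<Sum>m\<in>UNIV. - (?r j k l m * p $ l * x $ m)
           - \<i> * (p $ l * complex_of_real (s_lam \<epsilon> $ l $ k $ j $ m) * x $ m))"
      by (intro sum.cong refl) (simp add: w_lam_def r_std_swap_left[of \<epsilon> _ k j] algebra_simps)
    also have "\<dots> = - (\<Sum>l\<in>UNIV. \<Sum>m\<in>UNIV. ?r j k l m * p $ l * x $ m)
       - \<i> * (\<Sum>l\<in>UNIV. \<Sum>m\<in>UNIV. p $ l * complex_of_real (s_lam \<epsilon> $ l $ k $ j $ m) * x $ m)"
      by (simp add: sum_subtractf sum_negf sum_distrib_left)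
    finally show ?thesis
      unfolding br_px_def case_prod_conv s_lam_contraction by (simp add: algebra_simps)
  qed
  have "b $ j * a $ k * br_px \<epsilon> j k (x, p)
      = (if k = j then b $ j * a $ k else 0)
      + (\<Sum>l\<in>UNIV. \<Sum>m\<in>UNIV. ?r j k l m * (b $ j * p $ l) * (a $ k * x $ m))
      + \<i> * complex_of_real \<epsilon> * ((if k = j then cdot p x * (a $ k * b $ j) else 0)
          - (p $ k * a $ k) * (b $ j * x $ j) + (p $ j * b $ j) * (a $ k * x $ k))" for j k
    unfolding br by (simp add: algebra_simps sum_distrib_left)
  then have "(\<Sum>j\<in>UNIV. \<Sum>k\<in>UNIV. b $ j * a $ k * br_px \<epsilon> j k (x, p))
      = (\<Sum>j\<in>UNIV. b $ j * a $ j) + r_form \<epsilon> (\<lambda>j l. b $ j * p $ l) (\<lambda>k m. a $ k * x $ m)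
      + \<i> * complex_of_real \<epsilon> * (cdot p x * cdot a b
         - (\<Sum>j\<in>UNIV. \<Sum>k\<in>UNIV. (p $ k * a $ k) * (b $ j * x $ j))
         + (\<Sum>j\<in>UNIV. \<Sum>k\<in>UNIV. (p $ j * b $ j) * (a $ k * x $ k)))"
    by (simp add: r_form_def sum.distrib sum_subtractf sum_distrib_left[symmetric] cdot_def)
  moreover have "(\<Sum>j\<in>UNIV. \<Sum>k\<in>UNIV. (p $ k * a $ k) * (b $ j * x $ j)) = cdot p a * cdot b x"
    and "(\<Sum>j\<in>UNIV. \<Sum>k\<in>UNIV. (p $ j * b $ j) * (a $ k * x $ k)) = cdot p b * cdot a x"
    by (simp_all only: cdot_def sum_distrib_left[symmetric] sum_distrib_right[symmetric] mult.commute)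
  moreover have "(\<Sum>j\<in>UNIV. b $ j * a $ j) = cdot b a"
    by (simp add: cdot_def)
  ultimately show ?thesis
    by (simp only: s_form_def case_prod_conv)
qed

text \<open>Expanding the \<open>r\<close> term of \<open>bivector\<close> bilinearly gives four
  terms, one for each of the four groups of summands in \<open>pbracket\<close>.\<close>

lemma pbracket_bivector:
  "pbracket \<epsilon> f g z = bivector (\<i> * complex_of_real \<epsilon>) \<epsilon> z
     (grad_x f z) (grad_p f z) (grad_x g z) (grad_p g z)"
proof -
  obtain x p where z: "z = (x, p)" by (cases z)
  let ?t = "\<lambda>a x j l. a $ j * x $ l"
  let ?a = "grad_x f z" and ?b = "grad_p f z" and ?a' = "grad_x g z" and ?b' = "grad_p g z"
  let ?e = "\<i> * complex_of_real \<epsilon>"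
  have xx: "(\<Sum>j\<in>UNIV. \<Sum>k\<in>UNIV. ?a $ j * ?a' $ k * br_xx \<epsilon> j k z)
      = r_form \<epsilon> (?t ?a x) (?t ?a' x)"
    by (simp add: r_form_def z br_xx_def sum_distrib_left mult_ac)
  \<comment> \<open>In \<open>br_pp\<close> the point is contracted with the upper indices and the
    gradients with the lower ones. Transposing both legs repairs this, and the two signs
    cancel.\<close>
  have pp: "(\<Sum>j\<in>UNIV. \<Sum>k\<in>UNIV. ?b $ j * ?b' $ k * br_pp \<epsilon> j k z)
      = r_form \<epsilon> (?t ?b p) (?t ?b' p)"
  proof -
    have "?b $ j * ?b' $ k * br_pp \<epsilon> j k z = (\<Sum>l\<in>UNIV. \<Sum>m\<in>UNIV.
        complex_of_real (r_std \<epsilon> $ j $ k $ l $ m) * (?b $ j * p $ l) * (?b' $ k * p $ m))" for j k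
      unfolding z br_pp_def case_prod_conv sum_distrib_left
      by (intro sum.cong refl) (subst r_std_swap_left, subst r_std_swap_right, simp)
    then show ?thesis by (simp add: r_form_def)
  qed
  have px: "(\<Sum>j\<in>UNIV. \<Sum>k\<in>UNIV. ?b $ j * ?a' $ k * br_px \<epsilon> j k z)
      = cdot ?b ?a' + r_form \<epsilon> (?t ?b p) (?t ?a' x) + ?e * s_form z ?a' ?b"
    using br_px_contraction by (simp add: z)
  \<comment> \<open>Ordering the legs costs a sign, which cancels against the subtraction in
    \<open>pbracket\<close>.\<close>
  have xp: "(\<Sum>j\<in>UNIV. \<Sum>k\<in>UNIV. ?a $ k * ?b' $ j * br_px \<epsilon> j k z)
      = cdot ?b' ?a - r_form \<epsilon> (?t ?a x) (?t ?b' p) + ?e * s_form z ?a ?b'"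
  proof -
    have "?a $ k * ?b' $ j = ?b' $ j * ?a $ k" for j k
      by simp
    then show ?thesis
      using br_px_contraction[of ?b' ?a \<epsilon> x p] r_form_swap[of \<epsilon> "?t ?b' p" "?t ?a x"]
      by (simp only: z) simp
  qed
  have "moment z a b = (\<lambda>j l. (?t a x j l + ?t b p j l) - (?t a x l j + ?t b p l j))" for a b
    by (simp add: moment_def z)
  then have "r_form \<epsilon> (moment z ?a ?b) (moment z ?a' ?b') / 4
      = r_form \<epsilon> (?t ?a x) (?t ?a' x) + r_form \<epsilon> (?t ?b p) (?t ?b' p)
        + r_form \<epsilon> (?t ?b p) (?t ?a' x) + r_form \<epsilon> (?t ?a x) (?t ?b' p)"
    using r_form_antisymmetrize[of \<epsilon> "\<lambda>j l. ?t ?a x j l + ?t ?b p j l" "\<lambda>j l. ?t ?a' x j l + ?t ?b' p j l"]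
    by (simp add: r_form_add_left r_form_add_right)
  then show ?thesis
    unfolding bivector_def px_form_def pbracket_def sum.distrib sum_subtractf
    using xx pp px xp by (simp add: grad_x_def grad_p_def)
qed

section \<open>Pulling back the Euclidean part\<close>

lemma cdot_diff_left: "cdot (u - v) w = cdot u w - cdot v w"
  by (simp add: cdot_def sum_subtractf algebra_simps)

lemma cdot_diff_right: "cdot w (u - v) = cdot w u - cdot w v"
  by (simp add: cdot_def sum_subtractf algebra_simps)

context
  fixes e L I :: complex and x p q :: "complex^'n"
  assumes L: "L = 1 + 2 * e * cdot p x + e\<^sup>2 * cdot x x * cdot p p" and I: "I * L = 1"
    and q: "q = I *s (p + (e * cdot p p) *s x)"
begin

text \<open>The square of \<open>p + (e * cdot p p) *s x\<close> is \<open>cdot p p * L\<close>, and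
  \<open>I * L = 1\<close> cancels one factor \<open>I\<close>.\<close>

lemma cdot_q_q: "cdot q q = I * cdot p p"
  unfolding q cdot_bilinear cdot_commute[of x p] using I unfolding L by algebra

text \<open>The second argument on the left is the \<open>dp\<close> component of the pullback of a
  covector with components \<open>a\<close>, \<open>b\<close> at \<open>(x, q)\<close>. This is
  where the sign of \<open>e\<close> changes.\<close>

lemma px_form_pullback:
  "px_form e (x, p) a (I *s (b + (2 * e * cdot b x) *s p
      - (2 * e * cdot b q) *s (x + (e * cdot x x) *s p)))
    = px_form (- e) (x, q) a b"
proof -
  \<comment> \<open>Naming all pairings leaves a polynomial identity in scalars, to be checked
    modulo \<open>I * L = 1\<close>.\<close>
  define E x2 p2 where "E = cdot p x" and "x2 = cdot x x" and "p2 = cdot p p"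
  define ax ap bx bp ab where "ax = cdot a x" and "ap = cdot a p" and "bx = cdot b x" and "bp = cdot b p"
    and "ab = cdot a b"
  have c: "cdot p x = E" "cdot x p = E" "cdot x x = x2" "cdot p p = p2"
    "cdot a x = ax" "cdot x a = ax" "cdot a p = ap" "cdot p a = ap"
    "cdot b x = bx" "cdot x b = bx" "cdot b p = bp" "cdot p b = bp"
    "cdot a b = ab" "cdot b a = ab"
    by (simp_all add: E_def x2_def p2_def ax_def ap_def bx_def bp_def ab_def cdot_commute)
  have "I * (1 + 2 * e * E + e\<^sup>2 * x2 * p2) = 1" using I by (simp add: L c)
  then show ?thesis
    unfolding px_form_def q s_form_def case_prod_conv cdot_bilinear cdot_diff_left cdot_diff_right c
    by algebra
qed

text \<open>The pullback adds to the \<open>dx\<close> component a term linear in \<open>b\<close>.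
  By this symmetry such terms cancel in the difference of the two \<open>px_form\<close> terms of
  \<open>bivector\<close>.\<close>

lemma px_form_symmetric:
  "px_form (- e) (x, q) ((e * cdot p p * I) *s b' - (2 * e * cdot b' q) *s q) b
    = px_form (- e) (x, q) ((e * cdot p p * I) *s b - (2 * e * cdot b q) *s q) b'"
proof -
  define qx bx b'x qb qb' bb' where "qx = cdot q x" and "bx = cdot b x" and "b'x = cdot b' x"
    and "qb = cdot q b" and "qb' = cdot q b'" and "bb' = cdot b b'"
  have c: "cdot q x = qx" "cdot b x = bx" "cdot b' x = b'x" "cdot q b = qb" "cdot b q = qb"
    "cdot q b' = qb'" "cdot b' q = qb'" "cdot b b' = bb'" "cdot b' b = bb'"
    by (simp_all add: qx_def bx_def b'x_def qb_def qb'_def bb'_def cdot_commute)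
  show ?thesis
    unfolding px_form_def s_form_def case_prod_conv cdot_bilinear cdot_diff_left cdot_diff_right
      cdot_q_q c
    by algebra
qed

end

section \<open>Gradients of conjugated functions\<close>

lemma has_derivative_vec:
  fixes g :: "'a::real_normed_vector \<Rightarrow> 'b::euclidean_space ^ 'n"
  assumes "\<And>i. ((\<lambda>t. g t $ i) has_derivative (\<lambda>t. g' t $ i)) (at a within S)"
  shows "(g has_derivative g') (at a within S)"
proof (subst has_derivative_componentwise_within, intro ballI)
  fix b :: "'b ^ 'n" assume "b \<in> Basis"
  then obtain i y where "b = axis i y"
    by (auto simp: Basis_vec_def)
  then show "((\<lambda>t. g t \<bullet> b) has_derivative (\<lambda>t. g' t \<bullet> b)) (at a within S)"
    using assms[of i] by (simp add: inner_axis has_derivative_inner_left)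
qed

lemma DERIV_axis: "((\<lambda>t::complex. axis j t $ i) has_field_derivative axis j 1 $ i) (at a)"
  by (cases "i = j") (auto simp: axis_def)

text \<open>Chain rule along a curve with complex parameter: complex linearity of \<open>D\<close>
  turns a real derivative into a complex one.\<close>

lemma complex_linear_derivative_curve:
  fixes f :: "('n::finite) phase_pt \<Rightarrow> complex"
  assumes f: "(f has_derivative D) (at (X 0, P 0))"
    and D: "\<And>c u v. D (c *s u, c *s v) = c * D (u, v)"
    and X: "\<And>i. ((\<lambda>t. X t $ i) has_field_derivative u $ i) (at 0)"
    and P: "\<And>i. ((\<lambda>t. P t $ i) has_field_derivative v $ i) (at 0)"
  shows "((\<lambda>t. f (X t, P t)) has_field_derivative D (u, v)) (at 0)"
proof -
  have "(X has_derivative (\<lambda>t. t *s u)) (at 0)" "(P has_derivative (\<lambda>t. t *s v)) (at 0)"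
    using X P by (auto intro!: has_derivative_vec simp: has_field_derivative_def mult_commute_abs)
  then have "((\<lambda>t. (X t, P t)) has_derivative (\<lambda>t. (t *s u, t *s v))) (at 0)"
    by (rule has_derivative_Pair)
  from has_derivative_compose[OF this f] show ?thesis
    by (simp add: has_field_derivative_def D mult_commute_abs)
qed

lemma derivative_eq_gradients:
  fixes f :: "('n::finite) phase_pt \<Rightarrow> complex"
  assumes f: "(f has_derivative D) (at (x, p))"
    and D: "\<And>c u v. D (c *s u, c *s v) = c * D (u, v)"
  shows "D (u, v) = cdot (grad_x f (x, p)) u + cdot (grad_p f (x, p)) v"
proof -
  have line: "((\<lambda>t. (y + axis j t) $ i) has_field_derivative axis j 1 $ i) (at 0)"
    and const: "((\<lambda>t. y $ i) has_field_derivative 0 $ i) (at (0::complex))" for y :: "complex^'n" and i j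
    using DERIV_add[OF DERIV_const DERIV_axis] by (simp_all del: axis_nth)
  have zero: "y + axis j 0 = y" for y :: "complex^'n" and j
    by simp
  have "((\<lambda>t. f (x + axis j t, p)) has_field_derivative D (axis j 1, 0)) (at 0)"
    and "((\<lambda>t. f (x, p + axis j t)) has_field_derivative D (0, axis j 1)) (at 0)" for j
    by (rule complex_linear_derivative_curve[OF _ D]; simp only: zero f line const)+
  then have dx: "dx j f (x, p) = D (axis j 1, 0)" and dp: "dp j f (x, p) = D (0, axis j 1)" for j
    by (simp_all add: dx_def dp_def DERIV_imp_deriv)
  interpret linear D
    using f by (rule has_derivative_linear)
  \<comment> \<open>The zeros are written as multiples so that complex homogeneity of
    \<open>D\<close> applies to each pair.\<close>
  have "D (u, v) = D ((\<Sum>j\<in>UNIV. (u $ j *s axis j 1, u $ j *s 0))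
      + (\<Sum>j\<in>UNIV. (v $ j *s 0, v $ j *s axis j 1)))"
    by (simp add: sum_prod basis_expansion)
  also have "\<dots> = (\<Sum>j\<in>UNIV. u $ j * D (axis j 1, 0)) + (\<Sum>j\<in>UNIV. v $ j * D (0, axis j 1))"
    by (simp only: add sum D)
  finally show ?thesis
    by (simp add: cdot_def grad_x_def grad_p_def dx dp mult.commute)
qed

lemma DERIV_cdot_lines:
  "((\<lambda>t. cdot (a + t *s b) (c + t *s d)) has_field_derivative cdot a d + cdot b c) (at 0)"
  unfolding cdot_bilinear by (auto intro!: derivative_eq_intros)

text \<open>\<open>star_op \<epsilon> f\<close> is the function \<open>?F\<close> below composed
  with \<open>(x, p) \<mapsto> (x, q)\<close>. The two conjugations in \<open>?F\<close> make it
  complex differentiable again, with gradients \<open>a\<close> and \<open>b\<close> at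
  \<open>(x, q)\<close>, and the chain rule applies along a line.\<close>

lemma star_op_directional_derivative:
  fixes \<epsilon> :: real and f :: "('n::finite) phase_pt \<Rightarrow> complex" and x p u v :: "complex^'n"
  defines "e \<equiv> \<i> * complex_of_real \<epsilon>" and "I \<equiv> 1 / Lam \<epsilon> (x, p)"
  defines "q \<equiv> I *s (p + (e * cdot p p) *s x)"
    and "a \<equiv> vcnj (grad_x f (psi \<epsilon> (x, p)))" and "b \<equiv> vcnj (grad_p f (psi \<epsilon> (x, p)))"
  assumes hol: "mv_holomorphic_on f (PC \<epsilon>)" and z: "(x, p) \<in> PC \<epsilon>"
  shows "((\<lambda>t. star_op \<epsilon> f (x + t *s u, p + t *s v)) has_field_derivative
    cdot a u + I * (cdot b v + 2 * e * cdot p v * cdot b x + e * cdot p p * cdot b u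
      - 2 * e * cdot b q * (cdot p u + cdot x v + e * cdot x u * cdot p p + e * cdot x x * cdot p v))) (at 0)"
proof -
  define L where "L = Lam \<epsilon> (x, p)"
  have L: "L \<noteq> 0" using z by (simp add: L_def PC_def)
  have psi: "psi \<epsilon> (x, p) = (vcnj x, vcnj q)"
    by (simp add: psi_alt q_def I_def e_def)
  obtain D where D: "(f has_derivative D) (at (psi \<epsilon> (x, p)))"
    and lin: "D (c *s u, c *s v) = c * D (u, v)" for c u v
    using hol psi_in_PC[OF z] at_within_open[OF _ open_PC] unfolding mv_holomorphic_on_def by metis
  let ?F = "\<lambda>(u, v). cnj (f (vcnj u, vcnj v))"
  let ?D = "\<lambda>(u, v). cnj (D (vcnj u, vcnj v))"
  define X P where "X = (\<lambda>t. x + t *s u)" and "P = (\<lambda>t. p + t *s v)"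
  define Q where "Q = (\<lambda>t. (1 / Lam \<epsilon> (X t, P t)) *s (P t + (e * cdot (P t) (P t)) *s X t))"
  have "bounded_linear (vcnj :: complex^'n \<Rightarrow> complex^'n)"
    unfolding linear_conv_bounded_linear[symmetric]
    by (auto intro!: linearI simp: vcnj_def vec_eq_iff)
  then have V: "((\<lambda>w. vcnj (h w)) has_derivative (\<lambda>w. vcnj (h' w))) F"
    if "(h has_derivative h') F" for h' F and h :: "'n phase_pt \<Rightarrow> complex^'n"
    using that by (rule bounded_linear.has_derivative)
  have "((\<lambda>w. (vcnj (fst w), vcnj (snd w))) has_derivative (\<lambda>w. (vcnj (fst w), vcnj (snd w)))) (at (x, q))"
    by (intro has_derivative_Pair V has_derivative_fst has_derivative_snd has_derivative_ident)
  moreover have "(f has_derivative D) (at (vcnj (fst (x, q)), vcnj (snd (x, q))))"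
    using D by (simp add: psi)
  ultimately have "((\<lambda>w. cnj (f (vcnj (fst w), vcnj (snd w)))) has_derivative
      (\<lambda>w. cnj (D (vcnj (fst w), vcnj (snd w))))) (at (x, q))"
    by (intro has_derivative_cnj) (rule has_derivative_compose)
  then have F: "(?F has_derivative ?D) (at (x, q))"
    by (simp add: case_prod_unfold)
  define M where "M = 2 * e * (cdot p u + cdot x v) + 2 * e\<^sup>2 * (cdot x u * cdot p p + cdot x x * cdot p v)"
  have Lt: "((\<lambda>t. Lam \<epsilon> (X t, P t)) has_field_derivative M) (at 0)"
    unfolding Lam_def case_prod_conv X_def P_def M_def
    by (auto intro!: derivative_eq_intros DERIV_cdot_lines
        simp: e_def power2_eq_square cdot_commute[of u x] cdot_commute[of v p] cdot_commute[of v x] algebra_simps)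
  \<comment> \<open>The derivative of \<open>Q\<close> at 0, obtained by differentiating the
    relation that \<open>Lam\<close> times \<open>q\<close> equals
    \<open>p + (e * cdot p p) *s x\<close>; \<open>M\<close> is the derivative of
    \<open>Lam\<close>.\<close>
  define w where "w = I *s (v + (2 * e * cdot p v) *s x + (e * cdot p p) *s u - M *s q)"
  have Qt: "((\<lambda>t. Q t $ i) has_field_derivative w $ i) (at 0)" for i
  proof -
    have Xi: "((\<lambda>t. X t $ i) has_field_derivative u $ i) (at 0)"
      and Pi: "((\<lambda>t. P t $ i) has_field_derivative v $ i) (at 0)"
      by (auto simp: X_def P_def intro!: derivative_eq_intros)
    have PP: "((\<lambda>t. cdot (P t) (P t)) has_field_derivative 2 * cdot p v) (at 0)"
      using DERIV_cdot_lines[of p v p v] by (simp add: P_def cdot_commute[of v p])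
    have 0: "X 0 = x" "P 0 = p" by (simp_all add: X_def P_def)
    have "((\<lambda>t. (P t $ i + e * cdot (P t) (P t) * X t $ i) / Lam \<epsilon> (X t, P t)) has_field_derivative
       ((v $ i + (e * (2 * cdot p v) * x $ i + e * cdot p p * u $ i)) * L
         - (p $ i + e * cdot p p * x $ i) * M) / (L * L)) (at 0)"
      using L by (auto intro!: derivative_eq_intros Xi Pi PP Lt simp: 0 L_def)
    moreover have "((v $ i + (e * (2 * cdot p v) * x $ i + e * cdot p p * u $ i)) * L
         - (p $ i + e * cdot p p * x $ i) * M) / (L * L) = w $ i"
      using L by (simp add: w_def q_def I_def L_def[symmetric] field_simps)
    ultimately show ?thesis
      by (simp add: Q_def add_divide_distrib)
  qed
  have "((\<lambda>t. ?F (X t, Q t)) has_field_derivative ?D (u, w)) (at 0)"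
  proof (rule complex_linear_derivative_curve)
    show "(?F has_derivative ?D) (at (X 0, Q 0))"
      using F by (simp add: X_def P_def Q_def q_def I_def)
    have "vcnj (c *s y) = cnj c *s vcnj y" for c and y :: "complex^'n"
      by (simp add: vcnj_def vec_eq_iff)
    then show "?D (c *s y, c *s y') = c * ?D (y, y')" for c y y'
      by (simp add: lin)
    show "((\<lambda>t. X t $ i) has_field_derivative u $ i) (at 0)" for i
      by (auto simp: X_def intro!: derivative_eq_intros)
  qed (rule Qt)
  moreover have "?F (X t, Q t) = star_op \<epsilon> f (x + t *s u, p + t *s v)" for t
    by (simp add: star_op_def psi_alt X_def P_def Q_def e_def)
  moreover have "?D (u, w) = cdot a u + cdot b w"
    using derivative_eq_gradients[OF D[unfolded psi] lin, of "vcnj u" "vcnj w"]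
    by (simp add: a_def b_def psi cdot_vcnj[symmetric] vcnj_vcnj)
  moreover have "cdot b w = I * (cdot b v + 2 * e * cdot p v * cdot b x + e * cdot p p * cdot b u
      - 2 * e * cdot b q * (cdot p u + cdot x v + e * cdot x u * cdot p p + e * cdot x x * cdot p v))"
    unfolding w_def M_def cdot_bilinear cdot_diff_right by (simp add: power2_eq_square algebra_simps)
  ultimately show ?thesis
    by simp
qed

lemma axis_cdot: "cdot u (axis j 1) = u $ j"
  by (simp add: cdot_def axis_def if_distrib cong: if_cong)

text \<open>Lines along the coordinate axes give the pulled-back covector: its \<open>dx\<close>
  part is \<open>a\<close> plus a term linear in \<open>b\<close>, and its \<open>dp\<close> part is
  linear in \<open>b\<close> alone.\<close>

lemma star_op_gradients:
  fixes \<epsilon> :: real and f :: "('n::finite) phase_pt \<Rightarrow> complex" and x p :: "complex^'n"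
  defines "e \<equiv> \<i> * complex_of_real \<epsilon>" and "I \<equiv> 1 / Lam \<epsilon> (x, p)"
  defines "q \<equiv> I *s (p + (e * cdot p p) *s x)"
    and "a \<equiv> vcnj (grad_x f (psi \<epsilon> (x, p)))" and "b \<equiv> vcnj (grad_p f (psi \<epsilon> (x, p)))"
  assumes hol: "mv_holomorphic_on f (PC \<epsilon>)" and z: "(x, p) \<in> PC \<epsilon>"
  shows "grad_x (star_op \<epsilon> f) (x, p) = a + ((e * cdot p p * I) *s b - (2 * e * cdot b q) *s q)"
    and "grad_p (star_op \<epsilon> f) (x, p) = I *s (b + (2 * e * cdot b x) *s p
      - (2 * e * cdot b q) *s (x + (e * cdot x x) *s p))"
proof -
  note D = star_op_directional_derivative[OF hol z, folded e_def I_def, folded q_def a_def b_def]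
  have axis: "t *s axis j 1 = axis j t" for t :: complex and j :: 'n
    by (simp add: vec_eq_iff axis_def)
  have zero: "y + t *s 0 = y" "cdot y 0 = 0" for t and y :: "complex^'n"
    by (simp_all add: cdot_def vec_eq_iff)
  have "dx j (star_op \<epsilon> f) (x, p) = a $ j + I * (e * cdot p p * b $ j
      - 2 * e * cdot b q * (p $ j + e * x $ j * cdot p p))" for j
    using DERIV_imp_deriv[OF D[of "axis j 1" 0]] by (simp add: dx_def zero axis axis_cdot)
  then show "grad_x (star_op \<epsilon> f) (x, p) = a + ((e * cdot p p * I) *s b - (2 * e * cdot b q) *s q)"
    by (simp add: grad_x_def vec_eq_iff q_def algebra_simps)
  have "dp j (star_op \<epsilon> f) (x, p) = I * (b $ j + 2 * e * p $ j * cdot b x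
      - 2 * e * cdot b q * (x $ j + e * cdot x x * p $ j))" for j
    using DERIV_imp_deriv[OF D[of 0 "axis j 1"]] by (simp add: dp_def zero axis axis_cdot)
  then show "grad_p (star_op \<epsilon> f) (x, p) = I *s (b + (2 * e * cdot b x) *s p
      - (2 * e * cdot b q) *s (x + (e * cdot x x) *s p))"
    by (simp add: grad_p_def vec_eq_iff algebra_simps)
qed

section \<open>Invariance of the bivector\<close>

text \<open>Wedges of \<open>p\<close> with \<open>p\<close> and of \<open>x\<close> with
  \<open>x\<close> vanish, and the terms carrying \<open>cdot b q\<close> leave
  \<open>p \<and> x + x \<and> p = 0\<close>. What survives is \<open>a \<and> x\<close> plus
  \<open>b\<close> wedged with \<open>I *s (p + (e * cdot p p) *s x)\<close>, which is
  \<open>q\<close>.\<close>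

lemma moment_pullback:
  assumes q: "q = I *s (p + (e * cdot p p) *s x)"
  shows "moment (x, p) (a + ((e * cdot p p * I) *s b - (2 * e * cdot b q) *s q))
      (I *s (b + (2 * e * cdot b x) *s p - (2 * e * cdot b q) *s (x + (e * cdot x x) *s p)))
    = moment (x, q) a b"
proof (intro ext)
  fix j l
  define c where "c = cdot b q"
  have "q $ i = I * (p $ i + e * cdot p p * x $ i)" for i
    by (simp add: q algebra_simps)
  then show "moment (x, p) (a + ((e * cdot p p * I) *s b - (2 * e * cdot b q) *s q))
      (I *s (b + (2 * e * cdot b x) *s p - (2 * e * cdot b q) *s (x + (e * cdot x x) *s p))) j l
    = moment (x, q) a b j l"
    unfolding c_def[symmetric] by (simp add: moment_def algebra_simps)
qed

lemma cnj_r_form: "cnj (r_form \<epsilon> A B) = r_form \<epsilon> (\<lambda>j l. cnj (A j l)) (\<lambda>k m. cnj (B k m))"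
  by (simp add: r_form_def)

text \<open>The coefficients of \<open>r\<close> are real and \<open>cdot\<close> is bilinear, so
  \<open>e\<close> is the only coefficient that conjugation affects.\<close>

lemma cnj_bivector:
  "cnj (bivector e \<epsilon> (vcnj x, vcnj p) a b a' b')
    = bivector (cnj e) \<epsilon> (x, p) (vcnj a) (vcnj b) (vcnj a') (vcnj b')"
proof -
  have "cnj (px_form e (vcnj x, vcnj p) c d) = px_form (cnj e) (x, p) (vcnj c) (vcnj d)" for c d
    by (simp add: px_form_def s_form_def cdot_vcnj[symmetric] vcnj_vcnj)
  moreover have "(\<lambda>j l. cnj (moment (vcnj x, vcnj p) c d j l)) = moment (x, p) (vcnj c) (vcnj d)" for c d
    by (simp add: moment_def vcnj_def)
  ultimately show ?thesis
    by (simp add: bivector_def cnj_r_form)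
qed

lemma bivector_pullback:
  assumes L: "L = 1 + 2 * e * cdot p x + e\<^sup>2 * cdot x x * cdot p p" and I: "I * L = 1"
    and q: "q = I *s (p + (e * cdot p p) *s x)"
  defines "A \<equiv> \<lambda>b. (e * cdot p p * I) *s b - (2 * e * cdot b q) *s q"
    and "B \<equiv> \<lambda>b. I *s (b + (2 * e * cdot b x) *s p - (2 * e * cdot b q) *s (x + (e * cdot x x) *s p))"
  shows "bivector e \<epsilon> (x, p) (a + A b) (B b) (a' + A b') (B b') = bivector (- e) \<epsilon> (x, q) a b a' b'"
proof -
  have add: "px_form (- e) (x, q) (c + c') d = px_form (- e) (x, q) c d + px_form (- e) (x, q) c' d" for c c' d
    by (simp add: px_form_def s_form_def cdot_bilinear algebra_simps)
  \<comment> \<open>\<open>px_form_pullback\<close> is applied with the whole \<open>dx\<close>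
    component as first argument; additivity then isolates the \<open>A\<close> terms, which cancel
    by symmetry.\<close>
  have "px_form e (x, p) (a' + A b') (B b) - px_form e (x, p) (a + A b) (B b')
      = px_form (- e) (x, q) a' b - px_form (- e) (x, q) a b'"
    using px_form_symmetric[OF L I q, of b' b] unfolding A_def B_def px_form_pullback[OF L I q]
    by (simp add: add)
  moreover have "moment (x, p) (a + A b) (B b) = moment (x, q) a b" for a b
    unfolding A_def B_def by (rule moment_pullback[OF q])
  ultimately show ?thesis
    by (simp add: bivector_def)
qed

theorem theorem7p1:
  fixes \<epsilon> :: real
    and f g :: "('n::{finite,linorder}) phase_pt \<Rightarrow> complex"
  assumes "mv_holomorphic_on f (PC \<epsilon>)"
    and "mv_holomorphic_on g (PC \<epsilon>)"
  shows "\<forall>z\<in>PC \<epsilon>. star_op \<epsilon> (pbracket \<epsilon> f g) z = pbracket \<epsilon> (star_op \<epsilon> f) (star_op \<epsilon> g) z"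
proof
  fix z :: "'n phase_pt" assume z: "z \<in> PC \<epsilon>"
  obtain x p where xp: "z = (x, p)"
    by (cases z)
  define e where "e = \<i> * complex_of_real \<epsilon>"
  define I where "I = 1 / Lam \<epsilon> (x, p)"
  define q where "q = I *s (p + (e * cdot p p) *s x)"
  \<comment> \<open>Since \<open>e\<^sup>2\<close> is minus the square of \<epsilon>, the last term
    now has a plus sign.\<close>
  have L: "Lam \<epsilon> (x, p) = 1 + 2 * e * cdot p x + e\<^sup>2 * cdot x x * cdot p p"
    by (simp add: Lam_def e_def power_mult_distrib)
  have I: "I * Lam \<epsilon> (x, p) = 1"
    using z by (simp add: I_def xp PC_def)
  note grad = star_op_gradients[of _ \<epsilon> x p, folded xp, OF _ z, unfolded xp, folded e_def I_def, folded q_def]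
  have "psi \<epsilon> z = (vcnj x, vcnj q)"
    by (simp add: xp psi_alt q_def I_def e_def)
  \<comment> \<open>As \<open>e\<close> is purely imaginary, conjugation produces
    \<open>- e\<close>, the parameter that the pullback produces as well.\<close>
  then have "star_op \<epsilon> (pbracket \<epsilon> f g) z = bivector (- e) \<epsilon> (x, q)
      (vcnj (grad_x f (psi \<epsilon> z))) (vcnj (grad_p f (psi \<epsilon> z)))
      (vcnj (grad_x g (psi \<epsilon> z))) (vcnj (grad_p g (psi \<epsilon> z)))"
    by (simp add: star_op_def pbracket_bivector cnj_bivector e_def)
  also have "\<dots> = pbracket \<epsilon> (star_op \<epsilon> f) (star_op \<epsilon> g) z"
    unfolding xp pbracket_bivector e_def[symmetric] grad[OF assms(1)] grad[OF assms(2)]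
    by (rule bivector_pullback[OF L I q_def, symmetric])
  finally show "star_op \<epsilon> (pbracket \<epsilon> f g) z = pbracket \<epsilon> (star_op \<epsilon> f) (star_op \<epsilon> g) z" .
qed

end
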